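(* Let $\Delta$ be a finite abstract simplicial complex of dimension $d-1$ with $\tilde h$-polynomial $\tilde h(x)$. Then $$x^d\,\tilde h\left(\frac{x+1}{x}\right)=\sum_{F\in\Delta}m_F\,x^{|F|},$$ where, for each face $F\in\Delta$, $$m_F:=\sum_{G\in\Delta,\ F\subseteq G}(-1)^{d-|G|}=(-1)^{d-1-|F|}\,\widetilde\chi\bigl(\mathrm{lk}_\Delta F\bigr)$$ (the second equality being part of the assertion). In particular, $m_\emptyset=(-1)^{d-1}\widetilde\chi(\Delta)$.
   Context: A simplicial complex $\Delta$ is a finite collection of finite sets (faces), containing the empty face, closed under taking subsets. The dimension of a face $F$ is $|F|-1$, and the dimension $d-1$ of $\Delta$ is the largest dimension of a face. For $0\le i\le d-1$ let $f_i$ be the number of $i$-dimensional faces of $\Delta$, and $f_{-1}=1$ (the empty face). The numbers $h_0,\dots,h_d$ are defined by the polynomial identity $\sum_{i=0}^{d}h_i x^i=\sum_{i=0}^{d}f_{i-1}x^i(1-x)^{d-i}$, and $\tilde h(x)=\sum_{i=0}^d h_i x^i$. The link of $F\in\Delta$ is $\mathrm{lk}_\Delta F=\{G\in\Delta: G\cap F=\emptyset,\ G\cup F\in\Delta\}$. The reduced Euler characteristic of a finite simplicial complex $\Gamma$ is $\widetilde\chi(\Gamma)=\sum_{G\in\Gamma}(-1)^{|G|-1}$ (the empty face contributes $-1$). The identity is one of rational functions in the variable $x$. *)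

theory Defs
  imports
    "HOL-Computational_Algebra.Polynomial_Factorial"
begin

definition abstract_simplicial_complex :: "'a set set \<Rightarrow> bool" where
  "abstract_simplicial_complex \<Delta> \<longleftrightarrow>
     finite \<Delta> \<and> (\<forall>F\<in>\<Delta>. finite F) \<and> {} \<in> \<Delta> \<and> (\<forall>F\<in>\<Delta>. \<forall>G. G \<subseteq> F \<longrightarrow> G \<in> \<Delta>)"

text \<open>Dimensions are integers: the empty face has dimension \<open>-1\<close>.\<close>

definition face_dim :: "'a set \<Rightarrow> int" where
  "face_dim F = int (card F) - 1"

definition complex_dim :: "'a set set \<Rightarrow> int" where
  "complex_dim \<Delta> = Max (face_dim ` \<Delta>)"

text \<open>The number \<open>d\<close> for a complex of dimension \<open>d - 1\<close>.\<close>

definition complex_rank :: "'a set set \<Rightarrow> nat" where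
  "complex_rank \<Delta> = nat (complex_dim \<Delta> + 1)"

definition f_num :: "'a set set \<Rightarrow> int \<Rightarrow> nat" where
  "f_num \<Delta> i = card {F\<in>\<Delta>. face_dim F = i}"

definition h_num :: "'a set set \<Rightarrow> nat \<Rightarrow> rat" where
  "h_num \<Delta> i =
     coeff (\<Sum>j\<le>complex_rank \<Delta>.
       of_nat (f_num \<Delta> (int j - 1)) * [:0, 1:] ^ j * (1 - [:0, 1:]) ^ (complex_rank \<Delta> - j)) i"

definition h_tilde :: "'a set set \<Rightarrow> rat poly" where
  "h_tilde \<Delta> = (\<Sum>i\<le>complex_rank \<Delta>. monom (h_num \<Delta> i) i)"

text \<open>The identity that defines the numbers \<open>h\<^sub>0, \<dots>, h\<^sub>d\<close>:
  no coefficient is lost by cutting off at \<open>d\<close>.\<close>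

lemma h_tilde_eq:
  "h_tilde \<Delta> =
     (\<Sum>j\<le>complex_rank \<Delta>.
       of_nat (f_num \<Delta> (int j - 1)) * [:0, 1:] ^ j * (1 - [:0, 1:]) ^ (complex_rank \<Delta> - j))"
  (is "_ = ?p")
proof -
  define d where "d = complex_rank \<Delta>"
  have "degree (of_nat (f_num \<Delta> (int j - 1)) * [:0, 1:] ^ j * (1 - [:0, 1:]) ^ (d - j) :: rat poly) \<le> d"
    if "j \<le> d" for j
  proof -
    have 1: "degree ([:0, 1:] ^ j :: rat poly) \<le> j"
      using degree_power_le[of "[:0, 1:] :: rat poly" j] by simp
    have "degree (1 - [:0, 1:] :: rat poly) \<le> 1"
      by (rule degree_diff_le) auto
    then have 2: "degree ((1 - [:0, 1:]) ^ (d - j) :: rat poly) \<le> d - j"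
      using degree_power_le[of "1 - [:0, 1:] :: rat poly" "d - j"]
      by (metis le_trans mult_1 mult_le_mono1)
    have 3: "degree (of_nat (f_num \<Delta> (int j - 1)) :: rat poly) = 0"
      by simp
    show ?thesis
      using degree_mult_le[of "of_nat (f_num \<Delta> (int j - 1)) * [:0, 1:] ^ j" "(1 - [:0, 1:]) ^ (d - j) :: rat poly"]
        degree_mult_le[of "of_nat (f_num \<Delta> (int j - 1))" "[:0, 1:] ^ j :: rat poly"] 1 2 3 that
      by linarith
  qed
  then have "degree ?p \<le> d"
    unfolding d_def by (intro degree_sum_le) auto
  then show ?thesis
    unfolding h_tilde_def h_num_def d_def by (rule poly_as_sum_of_monoms')
qed

definition link :: "'a set set \<Rightarrow> 'a set \<Rightarrow> 'a set set" where
  "link \<Delta> F = {G\<in>\<Delta>. G \<inter> F = {} \<and> G \<union> F \<in> \<Delta>}"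

text \<open>Signs are written with integer exponents, since \<open>\<bar>G\<bar> - 1\<close> may be \<open>-1\<close>;
  the values are therefore taken in the field of rationals.\<close>

definition reduced_euler_char :: "'a set set \<Rightarrow> rat" where
  "reduced_euler_char \<Gamma> = (\<Sum>G\<in>\<Gamma>. (-1) powi (int (card G) - 1))"

definition m_num :: "'a set set \<Rightarrow> 'a set \<Rightarrow> rat" where
  "m_num \<Delta> F = (\<Sum>G | G \<in> \<Delta> \<and> F \<subseteq> G. (-1) powi (int (complex_rank \<Delta>) - int (card G)))"

text \<open>The field \<open>\<rat>(x)\<close> of rational functions, its constants and its variable.\<close>

type_synonym ratfun = "rat poly fract"

definition ratfun_const :: "rat \<Rightarrow> ratfun" where
  "ratfun_const c = to_fract [:c:]"

definition ratfun_X :: ratfun where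
  "ratfun_X = to_fract [:0, 1:]"

end

theory Submission
  imports Defs
begin

text \<open>
  Write \<open>d\<close> for the rank of \<open>\<Delta>\<close>. Sorting the faces by size turns the definition of the
  \<open>h\<close>-polynomial into a sum over faces (\<open>h_tilde_sum_faces\<close>),
  \<open>h(y) = (\<Sum>G\<in>\<Delta>. y\<^bsup>|G|\<^esup> (1 - y)\<^bsup>d - |G|\<^esup>)\<close>.
  At \<open>y = (x + 1) / x\<close> the factor \<open>1 - y\<close> is \<open>-1 / x\<close>, so that \<open>x\<^sup>d\<close> cancels every
  denominator and \<open>G\<close> contributes \<open>(-1)\<^bsup>d - |G|\<^esup> (x + 1)\<^bsup>|G|\<^esup>\<close>. The binomial theorem
  in the form \<open>(x + 1)\<^bsup>|G|\<^esup> = (\<Sum>F \<subseteq> G. x\<^bsup>|F|\<^esup>)\<close> (\<open>sum_subsets_power_card\<close>) and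
  an exchange of the two summations attach to each \<open>F\<close> the term \<open>m\<^sub>F x\<^bsup>|F|\<^esup>\<close>;
  subsets of faces being faces, no \<open>F\<close> outside \<open>\<Delta>\<close> occurs.

  The second equality (\<open>m_num_eq_reduced_euler_char_link\<close>) holds because
  \<open>G \<mapsto> G - F\<close> is a bijection from the faces containing \<open>F\<close> to the link of \<open>F\<close>, and \<open>d - |G|\<close> has the same parity as \<open>(d - 1 - |F|) + (|G - F| - 1)\<close>.
\<close>

text \<open>Substituting a rational function into a rational polynomial is a ring homomorphism, because
  the embedding of the constants is one. The following lemmas give this for any homomorphism \<open>f\<close>;
  they allow the substitution to be carried out factor by factor in the products
  \<open>y\<^bsup>|G|\<^esup> (1 - y)\<^bsup>d - |G|\<^esup>\<close>.\<close>

lemma poly_map_poly_add: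
  fixes f :: "'a::comm_ring_1 \<Rightarrow> 'b::comm_ring_1"
  assumes "f 0 = 0" "\<And>a b. f (a + b) = f a + f b"
  shows "poly (map_poly f (p + q)) y = poly (map_poly f p) y + poly (map_poly f q) y"
  by (induction p q rule: poly_induct2) (simp_all add: map_poly_pCons assms algebra_simps)

lemma poly_map_poly_mult:
  fixes f :: "'a::comm_ring_1 \<Rightarrow> 'b::comm_ring_1"
  assumes "f 0 = 0" "\<And>a b. f (a + b) = f a + f b" "\<And>a b. f (a * b) = f a * f b"
  shows "poly (map_poly f (p * q)) y = poly (map_poly f p) y * poly (map_poly f q) y"
proof (induction p)
  case (pCons a p)
  have smult: "poly (map_poly f (smult a q)) y = f a * poly (map_poly f q) y"
    by (induction q) (simp_all add: map_poly_pCons assms algebra_simps)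
  have "poly (map_poly f (pCons a p * q)) y
      = poly (map_poly f (smult a q)) y + poly (map_poly f (pCons 0 (p * q))) y"
    by (simp add: poly_map_poly_add[OF assms(1,2)])
  then show ?case
    by (simp add: smult pCons.IH map_poly_pCons assms algebra_simps)
qed (simp add: assms)

lemma poly_map_poly_power:
  fixes f :: "'a::comm_ring_1 \<Rightarrow> 'b::comm_ring_1"
  assumes "f 0 = 0" "f 1 = 1" "\<And>a b. f (a + b) = f a + f b" "\<And>a b. f (a * b) = f a * f b"
  shows "poly (map_poly f (p ^ n)) y = poly (map_poly f p) y ^ n"
  by (induction n) (simp_all add: poly_map_poly_mult[OF assms(1,3,4)] assms)

lemma poly_map_poly_sum:
  fixes f :: "'a::comm_ring_1 \<Rightarrow> 'b::comm_ring_1"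
  assumes "f 0 = 0" "\<And>a b. f (a + b) = f a + f b"
  shows "poly (map_poly f (\<Sum>i\<in>A. p i)) y = (\<Sum>i\<in>A. poly (map_poly f (p i)) y)"
  by (induction A rule: infinite_finite_induct)
    (simp_all add: poly_map_poly_add[OF assms] assms)

lemma ratfun_const_0: "ratfun_const 0 = 0"
  and ratfun_const_1: "ratfun_const 1 = 1"
  and ratfun_const_add: "ratfun_const (a + b) = ratfun_const a + ratfun_const b"
  and ratfun_const_mult: "ratfun_const (a * b) = ratfun_const a * ratfun_const b"
  and ratfun_const_uminus: "ratfun_const (- a) = - ratfun_const a"
  by (simp_all add: ratfun_const_def flip: to_fract_add to_fract_mult to_fract_uminus one_pCons)

lemma ratfun_const_sum: "ratfun_const (\<Sum>i\<in>A. g i) = (\<Sum>i\<in>A. ratfun_const (g i))"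
  by (induction A rule: infinite_finite_induct) (simp_all add: ratfun_const_0 ratfun_const_add)

lemma ratfun_const_power: "ratfun_const (a ^ n) = ratfun_const a ^ n"
  by (induction n) (simp_all add: ratfun_const_1 ratfun_const_mult)

lemma ratfun_X_nonzero: "ratfun_X \<noteq> 0"
  by (simp add: ratfun_X_def)

lemma card_le_complex_rank:
  assumes "abstract_simplicial_complex \<Delta>" "G \<in> \<Delta>"
  shows "card G \<le> complex_rank \<Delta>"
proof -
  have "face_dim G \<le> complex_dim \<Delta>"
    using assms unfolding complex_dim_def abstract_simplicial_complex_def by (intro Max_ge) auto
  then show ?thesis
    by (simp add: complex_rank_def face_dim_def)
qed

lemma h_tilde_sum_faces:
  assumes "abstract_simplicial_complex \<Delta>"
  shows "h_tilde \<Delta> = (\<Sum>G\<in>\<Delta>. [:0, 1:] ^ card G * (1 - [:0, 1:]) ^ (complex_rank \<Delta> - card G))"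
proof -
  define g :: "nat \<Rightarrow> rat poly"
    where "g j = [:0, 1:] ^ j * (1 - [:0, 1:]) ^ (complex_rank \<Delta> - j)" for j
  have "(\<Sum>G\<in>\<Delta>. g (card G)) = (\<Sum>j\<le>complex_rank \<Delta>. \<Sum>G | G \<in> \<Delta> \<and> card G = j. g (card G))"
    using assms card_le_complex_rank[OF assms]
    by (intro sum.group[symmetric]) (auto simp: abstract_simplicial_complex_def)
  also have "\<dots> = (\<Sum>j\<le>complex_rank \<Delta>. of_nat (f_num \<Delta> (int j - 1)) * g j)"
    by (intro sum.cong) (auto simp: f_num_def face_dim_def)
  finally show ?thesis
    by (simp add: h_tilde_eq g_def mult.assoc)
qed

lemma sum_subsets_power_card:
  fixes x :: "'b::comm_ring_1"
  assumes "finite G"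
  shows "(\<Sum>F\<in>Pow G. x ^ card F) = (x + 1) ^ card G"
  using prod_add[OF assms, of "\<lambda>_. x" "\<lambda>_. 1"] by simp

text \<open>The product has denominator \<open>x\<^sup>k x\<^bsup>d - k\<^esup> = x\<^sup>d\<close>, and \<open>x (1 - (x + 1) / x) = -1\<close> is the
  source of the sign.\<close>

lemma clear_denominators:
  fixes x :: "'b::field"
  assumes "x \<noteq> 0" "k \<le> d"
  shows "x ^ d * (((x + 1) / x) ^ k * (1 - (x + 1) / x) ^ (d - k)) = (- 1) ^ (d - k) * (x + 1) ^ k"
proof -
  have "x ^ d = x ^ k * x ^ (d - k)"
    using assms(2) by (simp flip: power_add)
  then have "x ^ d * (((x + 1) / x) ^ k * (1 - (x + 1) / x) ^ (d - k))
      = (x * ((x + 1) / x)) ^ k * (x * (1 - (x + 1) / x)) ^ (d - k)"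
    by (simp only: power_mult_distrib mult_ac)
  moreover have "x * ((x + 1) / x) = x + 1" "x * (1 - (x + 1) / x) = - 1"
    using assms(1) by (simp_all add: field_simps)
  ultimately show ?thesis
    by (simp add: mult.commute)
qed

lemma h_tilde_expansion:
  assumes \<Delta>: "abstract_simplicial_complex \<Delta>"
  shows "ratfun_X ^ complex_rank \<Delta>
             * poly (map_poly ratfun_const (h_tilde \<Delta>)) ((ratfun_X + 1) / ratfun_X)
       = (\<Sum>F\<in>\<Delta>. ratfun_const (m_num \<Delta> F) * ratfun_X ^ card F)"
proof -
  define d where "d = complex_rank \<Delta>"
  define x where "x = ratfun_X"
  define y where "y = (x + 1) / x"
  note hom = ratfun_const_0 ratfun_const_1 ratfun_const_add ratfun_const_mult
  have fin: "finite \<Delta>" "\<And>G. G \<in> \<Delta> \<Longrightarrow> finite G"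
    and down: "\<And>F G. G \<in> \<Delta> \<Longrightarrow> F \<subseteq> G \<Longrightarrow> F \<in> \<Delta>"
    using \<Delta> by (auto simp: abstract_simplicial_complex_def)
  have card_le: "card G \<le> d" if "G \<in> \<Delta>" for G
    using card_le_complex_rank[OF \<Delta> that] by (simp add: d_def)
  have X: "poly (map_poly ratfun_const [:0, 1:]) y = y"
    by (simp add: map_poly_pCons hom)
  have "1 - [:0, 1:] = ([:1, - 1:] :: rat poly)"
    by (simp add: one_pCons)
  then have one_minus_X: "poly (map_poly ratfun_const (1 - [:0, 1:])) y = 1 - y"
    by (simp add: map_poly_pCons hom ratfun_const_uminus)
  have "x ^ d * poly (map_poly ratfun_const (h_tilde \<Delta>)) y
      = (\<Sum>G\<in>\<Delta>. x ^ d * (y ^ card G * (1 - y) ^ (d - card G)))"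
    by (simp only: h_tilde_sum_faces[OF \<Delta>] poly_map_poly_sum[OF hom(1,3)]
        poly_map_poly_mult[OF hom(1,3,4)] poly_map_poly_power[OF hom] X one_minus_X
        sum_distrib_left d_def)
  also have "\<dots> = (\<Sum>G\<in>\<Delta>. (- 1) ^ (d - card G) * (x + 1) ^ card G)"
    unfolding y_def x_def
    by (intro sum.cong refl clear_denominators ratfun_X_nonzero card_le)
  also have "\<dots> = (\<Sum>G\<in>\<Delta>. \<Sum>F | F \<in> \<Delta> \<and> F \<subseteq> G. (- 1) ^ (d - card G) * x ^ card F)"
  proof (intro sum.cong refl)
    fix G assume G: "G \<in> \<Delta>"
    then have "Pow G = {F \<in> \<Delta>. F \<subseteq> G}"
      using down by auto
    then show "(- 1) ^ (d - card G) * (x + 1) ^ card G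
        = (\<Sum>F | F \<in> \<Delta> \<and> F \<subseteq> G. (- 1) ^ (d - card G) * x ^ card F)"
      by (simp add: sum_distrib_left flip: sum_subsets_power_card[OF fin(2)[OF G]])
  qed
  also have "\<dots> = (\<Sum>F\<in>\<Delta>. \<Sum>G | G \<in> \<Delta> \<and> F \<subseteq> G. (- 1) ^ (d - card G) * x ^ card F)"
    by (rule sum.swap_restrict) (rule fin(1))+
  also have "\<dots> = (\<Sum>F\<in>\<Delta>. ratfun_const (m_num \<Delta> F) * x ^ card F)"
  proof (intro sum.cong refl)
    fix F
    have "ratfun_const ((- 1) powi (int d - int (card G))) = (- 1) ^ (d - card G)" if "G \<in> \<Delta>" for G
      using card_le[OF that]
      by (simp add: ratfun_const_power ratfun_const_uminus ratfun_const_1 flip: of_nat_diff)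
    then show "(\<Sum>G | G \<in> \<Delta> \<and> F \<subseteq> G. (- 1) ^ (d - card G) * x ^ card F)
        = ratfun_const (m_num \<Delta> F) * x ^ card F"
      by (simp add: m_num_def ratfun_const_sum sum_distrib_right flip: d_def)
  qed
  finally show ?thesis
    by (simp add: d_def x_def y_def)
qed

lemma bij_betw_Diff_link:
  assumes "abstract_simplicial_complex \<Delta>"
  shows "bij_betw (\<lambda>G. G - F) {G \<in> \<Delta>. F \<subseteq> G} (link \<Delta> F)"
proof (rule bij_betw_byWitness[where f' = "\<lambda>H. H \<union> F"])
  show "(\<lambda>G. G - F) ` {G \<in> \<Delta>. F \<subseteq> G} \<subseteq> link \<Delta> F"
    using assms by (auto simp: abstract_simplicial_complex_def link_def Un_absorb1)
qed (auto simp: link_def)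

lemma m_num_eq_reduced_euler_char_link:
  assumes \<Delta>: "abstract_simplicial_complex \<Delta>"
  shows "m_num \<Delta> F = (- 1) powi (int (complex_rank \<Delta>) - 1 - int (card F))
                       * reduced_euler_char (link \<Delta> F)"
proof -
  define d where "d = int (complex_rank \<Delta>)"
  have "(- 1 :: rat) powi (d - int (card G))
      = (- 1) powi (d - 1 - int (card F)) * (- 1) powi (int (card (G - F)) - 1)"
    if "G \<in> \<Delta>" "F \<subseteq> G" for G
  proof -
    have "finite G"
      using \<Delta> that by (auto simp: abstract_simplicial_complex_def)
    then have "card (G - F) + card F = card G"
      using that by (metis card_Diff_subset card_mono finite_subset le_add_diff_inverse2)
    then have "even (d - int (card G))
        \<longleftrightarrow> even ((d - 1 - int (card F)) + (int (card (G - F)) - 1))"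
      by presburger
    then show ?thesis
      by (simp add: power_int_minus_left flip: power_int_add)
  qed
  then have "m_num \<Delta> F = (\<Sum>G | G \<in> \<Delta> \<and> F \<subseteq> G.
      (- 1) powi (d - 1 - int (card F)) * (- 1) powi (int (card (G - F)) - 1))"
    unfolding m_num_def d_def[symmetric] by (intro sum.cong) auto
  also have "\<dots> = (\<Sum>H\<in>link \<Delta> F. (- 1) powi (d - 1 - int (card F)) * (- 1) powi (int (card H) - 1))"
    by (rule sum.reindex_bij_betw[OF bij_betw_Diff_link[OF \<Delta>]])
  finally show ?thesis
    by (simp add: reduced_euler_char_def sum_distrib_left d_def)
qed

theorem theorem2p2:
  fixes \<Delta> :: "'a set set" and d :: nat
  assumes "abstract_simplicial_complex \<Delta>"
    and "complex_dim \<Delta> = int d - 1"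
  shows "ratfun_X ^ d * poly (map_poly ratfun_const (h_tilde \<Delta>)) ((ratfun_X + 1) / ratfun_X)
           = (\<Sum>F\<in>\<Delta>. ratfun_const (m_num \<Delta> F) * ratfun_X ^ card F)
       \<and> (\<forall>F\<in>\<Delta>. m_num \<Delta> F
            = (-1) powi (int d - 1 - int (card F)) * reduced_euler_char (link \<Delta> F))
       \<and> m_num \<Delta> {} = (-1) powi (int d - 1) * reduced_euler_char \<Delta>"
proof -
  have d: "complex_rank \<Delta> = d"
    using assms(2) by (simp add: complex_rank_def)
  have "link \<Delta> {} = \<Delta>"
    by (simp add: link_def)
  then show ?thesis
    using h_tilde_expansion[OF assms(1)] m_num_eq_reduced_euler_char_link[OF assms(1)]
      m_num_eq_reduced_euler_char_link[OF assms(1), of "{}"]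
    by (simp add: d)
qed

end
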